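(* Let $T:\mathbb{R}^N\to 2^{\mathbb{R}^N}$ be a maximal monotone operator whose domain is all of $\mathbb{R}^N$ and such that $T^{-1}(0)\neq\varnothing$. Let $x^0\in\mathbb{R}^N$, $\tau>0$, $R>0$, and consider the sequence $\{x^k\}$ generated by the bundle algorithm described in the context. Then either the sequence $\{x^k\}$ is finite and its last element belongs to $T^{-1}(0)$, or it is infinite and converges to a solution of the inclusion $0\in T(x)$.
   Context: Conventions. $\mathbb{R}^N$ carries the Euclidean inner product $\langle\cdot,\cdot\rangle$ and norm $\|\cdot\|$; $T^{-1}(0)=\{x: 0\in T(x)\}$. For a finite nonempty index set $I$, $\Delta_I=\{(\lambda_i)_{i\in I}: \lambda_i\ge 0,\ \sum_{i\in I}\lambda_i=1\}$. The bundle algorithm. Data: $x^0\in\mathbb{R}^N$, $\tau>0$, $R>0$. Initialization: $k:=0$, $p:=0$. Whenever the algorithm asks for an element of $T$ at a point, some element is chosen (given by an oracle). Step 0 (stopping test). (0.a) Compute $u^k\in T(x^k)$; if $u^k=0$, STOP. (0.b) Else set $p:=p+1$, $(z^p,w^p):=(x^k,u^k)$, and $n:=0$. Step 1 (search direction). (1.a) Set $j:=0$. (1.b) Let $\widehat I_{k,n,j}:=\{1\le i\le p: \|z^i-x^k\|\le R\,2^{-j}\}$. (1.c) Let $\alpha^{k,n,j}$ be a minimizer of $\|\sum_{i\in\widehat I_{k,n,j}}\alpha_i w^i\|^2$ over $\alpha\in\Delta_{\widehat I_{k,n,j}}$. (1.d) Let $s^{k,n,j}:=\sum_{i\in\widehat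 I_{k,n,j}}\alpha^{k,n,j}_i w^i$. (1.e) If $\|s^{k,n,j}\|\le\tau 2^{-j}$, set $j:=j+1$ and loop to (1.b). (1.f) Else define $j_{k,n}:=j$ and $s^{k,n}:=s^{k,n,j_{k,n}}$. Step 2 (line search). (2.a) Set $l:=0$. (2.b) Let $\sigma_{k,n,l}:=R\,2^{-l}/\|s^{k,n}\|$. (2.c) Let $y^{k,n,l}:=x^k-\sigma_{k,n,l}s^{k,n}$ and take $\xi^{k,n,l}\in T(y^{k,n,l})$. (2.d) Let $I_{k,n,l}:=\{1\le i\le p: \|z^i-y^{k,n,l}\|\le R\,2^{-l}\}$. (2.e) Take any $\lambda\in\Delta_{I_{k,n,l}}$ and set $v^{k,n,l}:=\sum_{i\in I_{k,n,l}}\lambda_i w^i$. (2.g) If [$\langle v^{k,n,l},s^{k,n}\rangle<\frac12\|s^{k,n}\|^2$ or $\langle s^{k,n},\xi^{k,n,l}\rangle<\frac12\|s^{k,n}\|^2$] and $l<j_{k,n}+1$, set $l:=l+1$ and loop to (2.b). (2.h) Else define $l_{k,n}:=l$, and $y^{k,n},v^{k,n},\xi^{k,n},\sigma_{k,n}$ as the values of $y^{k,n,l},v^{k,n,l},\xi^{k,n,l},\sigma_{k,n,l}$ at $l=l_{k,n}$. Step 3. (3.a) (Null step) If $\langle v^{k,n},s^{k,n}\rangle<\frac12\|s^{k,n}\|^2$ or $\langle s^{k,n},\xi^{k,n}\rangle<\frac12\|s^{k,n}\|^2$, set $p:=p+1$, $(z^p,w^p):=(y^{k,n},\xi^{k,n})$,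 $n:=n+1$, and loop to (1.b) (the current value of $j$ is kept). (3.b) (Serious step) Else define $n_k:=n$, $j_k:=j_{k,n_k}$, $l_k:=l_{k,n_k}$, $s^k:=s^{k,n_k}$, $y^k:=y^{k,n_k}$, $v^k:=v^{k,n_k}$, $\xi^k:=\xi^{k,n_k}$, $\sigma_k:=\sigma_{k,n_k}$, compute $x^{k+1}:=x^k-\frac{\langle x^k-y^k,\xi^k\rangle}{\|\xi^k\|^2}\xi^k$, set $k:=k+1$ and loop to Step 0. The sequence $\{x^k\}$ consists of $x^0$ and all points $x^{k+1}$ produced by serious steps; it is finite if only finitely many serious steps occur (because the algorithm stops in (0.a) or loops forever without updating $k$). *)

theory Defs
  imports "HOL-Analysis.Analysis"
begin

definition monotone_op :: "('a::real_inner \<Rightarrow> 'a set) \<Rightarrow> bool" where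
  "monotone_op T \<longleftrightarrow> (\<forall>x y. \<forall>u\<in>T x. \<forall>v\<in>T y. (u - v) \<bullet> (x - y) \<ge> 0)"

definition maximal_monotone :: "('a::real_inner \<Rightarrow> 'a set) \<Rightarrow> bool" where
  "maximal_monotone T \<longleftrightarrow>
     monotone_op T \<and> (\<forall>S. monotone_op S \<and> (\<forall>x. T x \<subseteq> S x) \<longrightarrow> S = T)"

definition op_dom :: "('a::real_inner \<Rightarrow> 'a set) \<Rightarrow> 'a set" where
  "op_dom T = {x. T x \<noteq> {}}"

definition op_zeros :: "('a::real_inner \<Rightarrow> 'a set) \<Rightarrow> 'a set" where
  "op_zeros T = {x. 0 \<in> T x}"

(* Weights are total functions on nat; only their values on I matter, since
   they are used exclusively inside sums over I. *)
definition unit_simplex :: "nat set \<Rightarrow> (nat \<Rightarrow> real) set" where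
  "unit_simplex I = {\<alpha>. (\<forall>i\<in>I. 0 \<le> \<alpha> i) \<and> (\<Sum>i\<in>I. \<alpha> i) = 1}"

definition bundle_near :: "nat \<Rightarrow> (nat \<Rightarrow> 'a::real_inner) \<Rightarrow> 'a \<Rightarrow> real \<Rightarrow> nat set" where
  "bundle_near p z a r = {i. 1 \<le> i \<and> i \<le> p \<and> norm (z i - a) \<le> r}"

definition insufficient :: "'a::real_inner \<Rightarrow> 'a \<Rightarrow> 'a \<Rightarrow> bool" where
  "insufficient s v \<xi> \<longleftrightarrow> v \<bullet> s < (norm s)\<^sup>2 / 2 \<or> s \<bullet> \<xi> < (norm s)\<^sup>2 / 2"

(* A configuration is a control location together with the values of the
   program variables that are live there:
     Stopped k x                   terminated because the oracle returned 0 at x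
     Step0 k x p z w               about to call the oracle at x
     Step1 k x p z w n j           about to compute a search direction
     Step2 k x p z w n j s l       about to try line-search index l along s
     Step3 k x p z w n j s y v xi  line search finished with y, v, xi
   Here x is the current iterate x^k, n counts the null steps made at x^k, and
   the bundle is the family (z i, w i) for 1 <= i <= p; the values of z, w outside
   {1..p} are irrelevant. A null step keeps j, a serious step resets it. *)
datatype 'a config =
    Stopped (counter: nat) (iter: 'a)
  | Step0 (counter: nat) (iter: 'a) nat "nat \<Rightarrow> 'a" "nat \<Rightarrow> 'a"
  | Step1 (counter: nat) (iter: 'a) nat "nat \<Rightarrow> 'a" "nat \<Rightarrow> 'a" nat nat
  | Step2 (counter: nat) (iter: 'a) nat "nat \<Rightarrow> 'a" "nat \<Rightarrow> 'a" nat nat 'a nat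
  | Step3 (counter: nat) (iter: 'a) nat "nat \<Rightarrow> 'a" "nat \<Rightarrow> 'a" nat nat 'a 'a 'a 'a

(* Every choice left open by the algorithm (oracle answers, minimizers, simplex
   weights) is nondeterministic, and repeated oracle calls at the same point
   may return different elements. *)
inductive bundle_step ::
  "('a::real_inner \<Rightarrow> 'a set) \<Rightarrow> real \<Rightarrow> real \<Rightarrow> 'a config \<Rightarrow> 'a config \<Rightarrow> bool"
  for T :: "'a \<Rightarrow> 'a set" and \<tau> R :: real where
  stop:
    "\<lbrakk> u \<in> T x; u = 0 \<rbrakk>
     \<Longrightarrow> bundle_step T \<tau> R (Step0 k x p z w) (Stopped k x)"
| start:
    "\<lbrakk> u \<in> T x; u \<noteq> 0 \<rbrakk>
     \<Longrightarrow> bundle_step T \<tau> R (Step0 k x p z w)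
           (Step1 k x (p + 1) (z(p + 1 := x)) (w(p + 1 := u)) 0 0)"
| direction_loop:
    "\<lbrakk> I = bundle_near p z x (R / 2 ^ j);
       is_arg_min (\<lambda>\<beta>. (norm (\<Sum>i\<in>I. \<beta> i *\<^sub>R w i))\<^sup>2) (\<lambda>\<beta>. \<beta> \<in> unit_simplex I) \<alpha>;
       s = (\<Sum>i\<in>I. \<alpha> i *\<^sub>R w i);
       norm s \<le> \<tau> / 2 ^ j \<rbrakk>
     \<Longrightarrow> bundle_step T \<tau> R (Step1 k x p z w n j) (Step1 k x p z w n (j + 1))"
| direction_found:
    "\<lbrakk> I = bundle_near p z x (R / 2 ^ j);
       is_arg_min (\<lambda>\<beta>. (norm (\<Sum>i\<in>I. \<beta> i *\<^sub>R w i))\<^sup>2) (\<lambda>\<beta>. \<beta> \<in> unit_simplex I) \<alpha>;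
       s = (\<Sum>i\<in>I. \<alpha> i *\<^sub>R w i);
       \<not> norm s \<le> \<tau> / 2 ^ j \<rbrakk>
     \<Longrightarrow> bundle_step T \<tau> R (Step1 k x p z w n j) (Step2 k x p z w n j s 0)"
| search_loop:
    "\<lbrakk> \<sigma> = (R / 2 ^ l) / norm s;
       y = x - \<sigma> *\<^sub>R s;
       \<xi> \<in> T y;
       I = bundle_near p z y (R / 2 ^ l);
       \<beta> \<in> unit_simplex I;
       v = (\<Sum>i\<in>I. \<beta> i *\<^sub>R w i);
       insufficient s v \<xi> \<and> l < j + 1 \<rbrakk>
     \<Longrightarrow> bundle_step T \<tau> R (Step2 k x p z w n j s l) (Step2 k x p z w n j s (l + 1))"
| search_done:
    "\<lbrakk> \<sigma> = (R / 2 ^ l) / norm s;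
       y = x - \<sigma> *\<^sub>R s;
       \<xi> \<in> T y;
       I = bundle_near p z y (R / 2 ^ l);
       \<beta> \<in> unit_simplex I;
       v = (\<Sum>i\<in>I. \<beta> i *\<^sub>R w i);
       \<not> (insufficient s v \<xi> \<and> l < j + 1) \<rbrakk>
     \<Longrightarrow> bundle_step T \<tau> R (Step2 k x p z w n j s l) (Step3 k x p z w n j s y v \<xi>)"
| null_step:
    "insufficient s v \<xi>
     \<Longrightarrow> bundle_step T \<tau> R (Step3 k x p z w n j s y v \<xi>)
           (Step1 k x (p + 1) (z(p + 1 := y)) (w(p + 1 := \<xi>)) (n + 1) j)"
| serious_step:
    "\<lbrakk> \<not> insufficient s v \<xi>;
       x' = x - (((x - y) \<bullet> \<xi>) / (norm \<xi>)\<^sup>2) *\<^sub>R \<xi> \<rbrakk>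
     \<Longrightarrow> bundle_step T \<tau> R (Step3 k x p z w n j s y v \<xi>) (Step0 (k + 1) x' p z w)"

(* A complete run. A run that stops is padded by repeating its final
   configuration; a run that does not stop makes infinitely many steps. *)
definition bundle_run ::
  "('a::real_inner \<Rightarrow> 'a set) \<Rightarrow> real \<Rightarrow> real \<Rightarrow> 'a \<Rightarrow> (nat \<Rightarrow> 'a config) \<Rightarrow> bool" where
  "bundle_run T \<tau> R x0 \<rho> \<longleftrightarrow>
     (\<exists>z w. \<rho> 0 = Step0 0 x0 0 z w) \<and>
     (\<forall>t. if is_Stopped (\<rho> t) then \<rho> (Suc t) = \<rho> t
          else bundle_step T \<tau> R (\<rho> t) (\<rho> (Suc t)))"

(* The indices k for which x^k is defined. *)
definition iterate_indices :: "(nat \<Rightarrow> 'a config) \<Rightarrow> nat set" where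
  "iterate_indices \<rho> = range (\<lambda>t. counter (\<rho> t))"

(* x^k; meaningful for k in iterate_indices \<rho>. The iterate only changes
   together with the counter, so the choice of the time t is immaterial. *)
definition iterate :: "(nat \<Rightarrow> 'a config) \<Rightarrow> nat \<Rightarrow> 'a" where
  "iterate \<rho> k = iter (\<rho> (LEAST t. counter (\<rho> t) = k))"

end

theory Submission
  imports Defs
begin

text \<open>
  A serious step projects the current iterate onto a half-space that contains every zero of \<open>T\<close>, so
  the distance to each zero decreases and the squared step lengths are summable
  (\<open>projection_step_fejer\<close>).  All evaluation points therefore stay in a fixed ball, on which the values
  of \<open>T\<close> are bounded by some \<open>M\<close> because \<open>T\<close> has full domain (\<open>monotone_op_bounded_on_cball\<close>).

  The level \<open>j\<close> at an iterate \<open>x\<close> is raised only when values of \<open>T\<close> at points within \<open>R / 2 ^ j\<close> of \<open>x\<close>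
  have a convex combination of norm at most \<open>\<tau> / 2 ^ j\<close>.  By monotonicity such a combination makes \<open>x\<close>
  an approximate zero, with an error proportional to \<open>1 / 2 ^ j\<close>; by maximality, a point that is an
  approximate zero with arbitrarily small error, or a limit of such points, is a zero
  (\<open>zero_if_approx_zero_geometric\<close>, \<open>approx_zero_limit\<close>).  So high levels are what has to be produced.

  With infinitely many serious steps, each is at least a constant times \<open>1 / 4 ^ j\<close> long, where \<open>j\<close> is
  its level.  Since the step lengths vanish, the levels tend to infinity, every cluster point of the
  iterates is a zero, and the monotone decrease of the distance to it turns this into convergence
  (\<open>fejer_sequence_converges_to_zero\<close>).

  With finitely many serious steps and no stop, the run stays at one iterate \<open>x\<close> forever.  If the levels
  were bounded, infinitely many null steps would occur at the same level \<open>j\<close>.  The search direction \<open>s\<close>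
  is the element of minimal norm in the convex hull of the nearby values, hence \<open>s \<bullet> b\<close> is at least
  \<open>(norm s)\<^sup>2\<close> for all of them, whereas the value \<open>\<xi>\<close> added by the null step has
  \<open>s \<bullet> \<xi> < (norm s)\<^sup>2 / 2\<close>.  Each later direction has to respect this new value, so no
  subsequence of the directions, whose norms exceed \<open>\<tau> / 2 ^ j\<close>, can converge; this is impossible in a
  bounded set (\<open>no_infinite_cut_sequence\<close>).
  Consequently the levels are unbounded (\<open>level_unbounded\<close>) and \<open>x\<close> is a zero.
\<close>

section \<open>Maximal monotone operators with full domain\<close>

lemma monotone_opD:
  assumes "monotone_op T" "u \<in> T x" "v \<in> T y"
  shows "0 \<le> (u - v) \<bullet> (x - y)"
  using assms by (auto simp: monotone_op_def)

text \<open>Otherwise adding the value \<open>0\<close> at \<open>x\<close> would extend \<open>T\<close> to a larger monotone operator.\<close>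

lemma maximal_monotone_zeroI:
  assumes max: "maximal_monotone T" and rel: "\<And>y v. v \<in> T y \<Longrightarrow> v \<bullet> (x - y) \<le> 0"
  shows "x \<in> op_zeros T"
proof -
  define S where "S = T(x := insert 0 (T x))"
  have mono: "monotone_op T"
    using max by (simp add: maximal_monotone_def)
  have "monotone_op S"
    unfolding monotone_op_def
  proof (intro allI ballI)
    fix a b u v
    assume "u \<in> S a" "v \<in> S b"
    then have u: "u \<in> T a \<or> a = x \<and> u = 0" and v: "v \<in> T b \<or> b = x \<and> v = 0"
      by (auto simp: S_def split: if_splits)
    from u v show "0 \<le> (u - v) \<bullet> (a - b)"
      using monotone_opD[OF mono, of u a v b] rel[of v b] rel[of u a]
      by (auto simp: inner_diff_right)
  qed
  then have "S = T"
    using max by (auto simp: maximal_monotone_def S_def)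
  moreover have "0 \<in> S x"
    by (simp add: S_def)
  ultimately show ?thesis
    by (simp add: op_zeros_def)
qed

text \<open>A ball is surrounded by the finitely many corners of a box.  Monotonicity against one chosen
  value at each corner bounds a value \<open>u\<close> at an inner point \<open>x\<close> along every direction from \<open>x\<close> to a
  corner, hence, by convexity, along the direction of \<open>u\<close> itself.\<close>

lemma monotone_op_bounded_on_cball:
  fixes T :: "'a::euclidean_space \<Rightarrow> 'a set"
  assumes mono: "monotone_op T" and dom: "op_dom T = UNIV"
  obtains M where "M > 0" "\<And>x u. \<lbrakk> x \<in> cball c r; u \<in> T x \<rbrakk> \<Longrightarrow> norm u \<le> M"
proof -
  obtain b where b: "cball c (r + 1) \<subseteq> cbox (- b) b"
    using bounded_subset_cbox_symmetric[OF bounded_cball] by blast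
  obtain P where P: "finite P" "cbox (- b) b = convex hull P"
    by (rule closed_interval_as_convex_hull)
  have "\<forall>p. \<exists>u. u \<in> T p"
    using dom by (auto simp: op_dom_def)
  then obtain V where V: "\<And>p. V p \<in> T p"
    by metis
  define C where "C = (\<Sum>p\<in>P. norm (V p) * (norm (p - c) + \<bar>r\<bar>))"
  have bound: "norm u \<le> C" if x: "x \<in> cball c r" and u: "u \<in> T x" for x u
  proof (cases "u = 0")
    case True
    then show ?thesis
      by (simp add: C_def sum_nonneg)
  next
    case False
    have corner: "u \<bullet> (p - x) \<le> C" if p: "p \<in> P" for p
    proof -
      have "u \<bullet> (p - x) \<le> V p \<bullet> (p - x)"
        using monotone_opD[OF mono u V[of p]] by (simp add: inner_diff_left inner_diff_right)
      also have "\<dots> \<le> norm (V p) * norm (p - x)"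
        by (rule norm_cauchy_schwarz)
      also have "\<dots> \<le> norm (V p) * (norm (p - c) + \<bar>r\<bar>)"
      proof (rule mult_left_mono)
        show "norm (p - x) \<le> norm (p - c) + \<bar>r\<bar>"
          using x norm_triangle_ineq[of "p - c" "c - x"] by (simp add: dist_norm)
      qed simp
      also have "\<dots> \<le> C"
        unfolding C_def using P(1) p by (intro member_le_sum) auto
      finally show ?thesis .
    qed
    have "convex hull P \<subseteq> {q. u \<bullet> q \<le> C + u \<bullet> x}"
      using corner by (intro hull_minimal convex_halfspace_le) (auto simp: inner_diff_right algebra_simps)
    \<comment> \<open>The box was taken around the ball of radius \<open>r + 1\<close> to leave room for a unit step along \<open>u\<close>.\<close>
    moreover have "x + u /\<^sub>R norm u \<in> cball c (r + 1)"
      using x False norm_triangle_ineq[of "c - x" "- (u /\<^sub>R norm u)"]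
      by (simp add: dist_norm algebra_simps)
    ultimately have "u \<bullet> (x + u /\<^sub>R norm u) \<le> C + u \<bullet> x"
      using b P(2) by blast
    moreover have "u \<bullet> (u /\<^sub>R norm u) = norm u"
      using False by (simp add: dot_square_norm power2_eq_square)
    ultimately show ?thesis
      by (simp add: inner_add_right)
  qed
  have "C \<ge> 0"
    by (simp add: C_def sum_nonneg)
  then show thesis
    using that[of "C + 1"] bound by fastforce
qed

text \<open>For \<open>\<epsilon> = 0\<close> this says that \<open>0\<close> is monotonically related at \<open>x\<close> to the graph of \<open>T\<close>.  The weight
  multiplying \<open>\<epsilon>\<close> may depend on \<open>y\<close> and \<open>v\<close>, since the limits in \<open>\<epsilon>\<close> and \<open>x\<close> are taken for fixed \<open>y\<close> and
  \<open>v\<close>; this freedom is what lets convex combinations of values at points near \<open>x\<close> certify it.\<close>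

definition approx_zero :: "('a::real_inner \<Rightarrow> 'a set) \<Rightarrow> real \<Rightarrow> 'a \<Rightarrow> bool" where
  "approx_zero T \<epsilon> x \<longleftrightarrow> (\<forall>y. \<forall>v\<in>T y. v \<bullet> (x - y) \<le> \<epsilon> * (1 + norm (x - y) + norm v))"

lemma approx_zero_limit:
  assumes "eventually (\<lambda>k. approx_zero T \<epsilon> (X k)) sequentially" "X \<longlonglongrightarrow> x"
  shows "approx_zero T \<epsilon> x"
  unfolding approx_zero_def
proof (intro allI ballI)
  fix y v
  assume v: "v \<in> T y"
  show "v \<bullet> (x - y) \<le> \<epsilon> * (1 + norm (x - y) + norm v)"
  proof (rule tendsto_le)
    show "(\<lambda>k. \<epsilon> * (1 + norm (X k - y) + norm v)) \<longlonglongrightarrow> \<epsilon> * (1 + norm (x - y) + norm v)"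
      by (intro tendsto_intros assms)
    show "(\<lambda>k. v \<bullet> (X k - y)) \<longlonglongrightarrow> v \<bullet> (x - y)"
      by (intro tendsto_intros assms)
    show "\<forall>\<^sub>F k in sequentially. v \<bullet> (X k - y) \<le> \<epsilon> * (1 + norm (X k - y) + norm v)"
      using assms(1) by eventually_elim (use v in \<open>auto simp: approx_zero_def\<close>)
  qed simp
qed

lemma zero_if_approx_zero_geometric:
  assumes "maximal_monotone T" "\<And>i. approx_zero T (K / 2 ^ i) x"
  shows "x \<in> op_zeros T"
proof (rule maximal_monotone_zeroI[OF assms(1)])
  fix y v
  assume v: "v \<in> T y"
  have "(\<lambda>i. (K / 2 ^ i) * (1 + norm (x - y) + norm v)) \<longlonglongrightarrow> 0 * (1 + norm (x - y) + norm v)"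
    by (intro tendsto_intros LIMSEQ_divide_realpow_zero) auto
  then show "v \<bullet> (x - y) \<le> 0"
    using v assms(2) by (intro LIMSEQ_le_const) (auto simp: approx_zero_def)
qed

text \<open>Each \<open>w i\<close> is monotonically related to \<open>v\<close> at the point \<open>z i\<close>; replacing \<open>z i\<close> by \<open>x\<close> costs at most
  \<open>r * (M + norm v)\<close>, and averaging with the weights \<open>\<alpha>\<close> leaves only the small combination.\<close>

lemma approx_zero_convex_combination:
  assumes mono: "monotone_op T" and \<alpha>: "\<alpha> \<in> unit_simplex I"
    and graph: "\<And>i. i \<in> I \<Longrightarrow> w i \<in> T (z i)"
    and near: "\<And>i. i \<in> I \<Longrightarrow> norm (z i - x) \<le> r"
    and bound: "\<And>i. i \<in> I \<Longrightarrow> norm (w i) \<le> M"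
    and small: "norm (\<Sum>i\<in>I. \<alpha> i *\<^sub>R w i) \<le> \<theta>"
    and \<epsilon>: "r * M \<le> \<epsilon>" "r \<le> \<epsilon>" "\<theta> \<le> \<epsilon>"
  shows "approx_zero T \<epsilon> x"
  unfolding approx_zero_def
proof (intro allI ballI)
  fix y v
  assume v: "v \<in> T y"
  let ?s = "\<Sum>i\<in>I. \<alpha> i *\<^sub>R w i"
  have \<alpha>0: "\<And>i. i \<in> I \<Longrightarrow> 0 \<le> \<alpha> i" and \<alpha>1: "(\<Sum>i\<in>I. \<alpha> i) = 1"
    using \<alpha> by (auto simp: unit_simplex_def)
  have each: "v \<bullet> (x - y) \<le> w i \<bullet> (x - y) + r * (M + norm v)" if i: "i \<in> I" for i
  proof -
    have "v \<bullet> (x - y) - w i \<bullet> (x - y) \<le> (w i - v) \<bullet> (z i - x)"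
      using monotone_opD[OF mono graph[OF i] v] by (simp add: inner_diff_left inner_diff_right)
    also have "\<dots> \<le> norm (w i - v) * norm (z i - x)"
      by (rule norm_cauchy_schwarz)
    also have "\<dots> \<le> (M + norm v) * r"
      using near[OF i] bound[OF i] norm_triangle_ineq4[of "w i" v] norm_ge_zero[of "w i"] norm_ge_zero[of v]
      by (intro mult_mono) (linarith | simp)+
    finally show ?thesis
      by (simp add: mult.commute)
  qed
  have "v \<bullet> (x - y) = (\<Sum>i\<in>I. \<alpha> i * (v \<bullet> (x - y)))"
    using \<alpha>1 by (simp flip: sum_distrib_right)
  also have "\<dots> \<le> (\<Sum>i\<in>I. \<alpha> i * (w i \<bullet> (x - y) + r * (M + norm v)))"
    using each \<alpha>0 by (intro sum_mono mult_left_mono) auto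
  also have "\<dots> = ?s \<bullet> (x - y) + r * (M + norm v)"
    using \<alpha>1 by (simp add: distrib_left sum.distrib inner_sum_left flip: sum_distrib_right)
  also have "?s \<bullet> (x - y) \<le> \<theta> * norm (x - y)"
    using norm_cauchy_schwarz[of ?s "x - y"] mult_right_mono[OF small, of "norm (x - y)"] by simp
  also have "\<theta> * norm (x - y) \<le> \<epsilon> * norm (x - y)"
    by (rule mult_right_mono[OF \<epsilon>(3)]) simp
  also have "r * (M + norm v) \<le> \<epsilon> + \<epsilon> * norm v"
    using \<epsilon>(1) mult_right_mono[OF \<epsilon>(2), of "norm v"] by (simp add: distrib_left)
  finally show "v \<bullet> (x - y) \<le> \<epsilon> * (1 + norm (x - y) + norm v)"
    by (simp add: algebra_simps)
qed

section \<open>Search directions and cuts\<close>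

lemma sum_simplex_ge:
  fixes c :: real
  assumes "\<beta> \<in> unit_simplex I" "\<And>i. i \<in> I \<Longrightarrow> c \<le> f i"
  shows "c \<le> (\<Sum>i\<in>I. \<beta> i * f i)"
proof -
  have "c = (\<Sum>i\<in>I. \<beta> i * c)"
    using assms(1) by (simp add: unit_simplex_def flip: sum_distrib_right)
  also have "\<dots> \<le> (\<Sum>i\<in>I. \<beta> i * f i)"
    using assms by (intro sum_mono mult_left_mono) (auto simp: unit_simplex_def)
  finally show ?thesis .
qed

lemma norm_simplex_combination_le:
  assumes \<alpha>: "\<alpha> \<in> unit_simplex I" and bound: "\<And>i. i \<in> I \<Longrightarrow> norm (w i) \<le> M"
  shows "norm (\<Sum>i\<in>I. \<alpha> i *\<^sub>R w i) \<le> M"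
proof -
  have "norm (\<Sum>i\<in>I. \<alpha> i *\<^sub>R w i) \<le> (\<Sum>i\<in>I. \<alpha> i * norm (w i))"
    using \<alpha> by (intro order_trans[OF norm_sum] sum_mono) (auto simp: unit_simplex_def)
  also have "\<dots> \<le> (\<Sum>i\<in>I. \<alpha> i * M)"
    using \<alpha> bound by (intro sum_mono mult_left_mono) (auto simp: unit_simplex_def)
  also have "\<dots> = M"
    using \<alpha> by (simp add: unit_simplex_def flip: sum_distrib_right)
  finally show ?thesis .
qed

text \<open>The combination \<open>s\<close> is the point closest to the origin on the segment from \<open>s\<close> to \<open>w i\<close>, all of whose
  points are again simplex combinations.\<close>

lemma min_norm_inner_ge:
  fixes w :: "nat \<Rightarrow> 'a::euclidean_space"
  assumes min: "is_arg_min (\<lambda>\<beta>. (norm (\<Sum>i\<in>I. \<beta> i *\<^sub>R w i))\<^sup>2) (\<lambda>\<beta>. \<beta> \<in> unit_simplex I) \<alpha>"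
    and fin: "finite I" and i: "i \<in> I"
  defines "s \<equiv> \<Sum>i\<in>I. \<alpha> i *\<^sub>R w i"
  shows "(norm s)\<^sup>2 \<le> w i \<bullet> s"
proof -
  have \<alpha>: "\<alpha> \<in> unit_simplex I"
    and least: "\<And>\<beta>. \<beta> \<in> unit_simplex I \<Longrightarrow> norm s \<le> norm (\<Sum>i\<in>I. \<beta> i *\<^sub>R w i)"
    using min by (auto simp: is_arg_min_linorder s_def)
  have "norm s \<le> norm q" if q: "q \<in> closed_segment s (w i)" for q
  proof -
    obtain u where u: "0 \<le> u" "u \<le> 1" "q = (1 - u) *\<^sub>R s + u *\<^sub>R w i"
      using q by (auto simp: in_segment)
    \<comment> \<open>Weights of \<open>q\<close>: those of \<open>s\<close>, moved by the fraction \<open>u\<close> towards the vertex \<open>i\<close>.\<close>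
    define \<beta> where "\<beta> m = (1 - u) * \<alpha> m + u * (if m = i then 1 else 0)" for m
    have "(\<Sum>m\<in>I. \<beta> m) = 1"
      using \<alpha> fin i unfolding \<beta>_def sum.distrib
      by (simp add: unit_simplex_def flip: sum_distrib_left)
    then have "\<beta> \<in> unit_simplex I"
      using \<alpha> u by (auto simp: unit_simplex_def \<beta>_def)
    moreover have "(\<Sum>m\<in>I. \<beta> m *\<^sub>R w m) = q"
    proof -
      have "(\<Sum>m\<in>I. \<beta> m *\<^sub>R w m) = (\<Sum>m\<in>I. (1 - u) *\<^sub>R (\<alpha> m *\<^sub>R w m) + (if m = i then u *\<^sub>R w m else 0))"
        by (intro sum.cong) (auto simp: \<beta>_def scaleR_add_left)
      also have "\<dots> = q"
        using fin i by (simp add: sum.distrib u s_def scaleR_sum_right)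
      finally show ?thesis .
    qed
    ultimately show ?thesis
      using least by metis
  qed
  then have "(0 - s) \<bullet> (w i - s) \<le> 0"
    by (intro any_closest_point_dot[of "closed_segment s (w i)"]) auto
  then show ?thesis
    by (simp add: inner_diff_right dot_square_norm inner_commute)
qed

text \<open>Along a convergent subsequence of \<open>s\<close> with limit \<open>L\<close>, the two inequalities for neighbouring
  members force \<open>(norm L)\<^sup>2 / 2 \<le> 0\<close>.\<close>

lemma no_infinite_cut_sequence:
  fixes s \<xi> :: "nat \<Rightarrow> 'a::euclidean_space"
  assumes s: "\<And>n. norm (s n) \<le> M" and \<xi>: "\<And>n. norm (\<xi> n) \<le> M"
    and c: "0 < c" "\<And>n. c \<le> norm (s n)"
    and later: "\<And>n m. n < m \<Longrightarrow> (norm (s m))\<^sup>2 \<le> s m \<bullet> \<xi> n"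
    and cut: "\<And>n. s n \<bullet> \<xi> n < (norm (s n))\<^sup>2 / 2"
  shows False
proof -
  have "\<forall>n. s n \<in> cball 0 M"
    using s by simp
  then obtain L r where r: "strict_mono r" and L: "(s \<circ> r) \<longlonglongrightarrow> L"
    using compact_imp_seq_compact[OF compact_cball, unfolded seq_compact_def] by blast
  define a where "a n = s (r n)" for n
  have a: "a \<longlonglongrightarrow> L"
    using L by (simp add: a_def[abs_def] comp_def)
  have aS: "(\<lambda>n. a (Suc n)) \<longlonglongrightarrow> L"
    using a by (rule LIMSEQ_Suc)
  have "(norm L)\<^sup>2 - (norm L)\<^sup>2 / 2 \<le> M * norm (L - L)"
  proof (rule LIMSEQ_le)
    show "(\<lambda>n. (norm (a (Suc n)))\<^sup>2 - (norm (a n))\<^sup>2 / 2) \<longlonglongrightarrow> (norm L)\<^sup>2 - (norm L)\<^sup>2 / 2"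
      by (intro tendsto_intros a aS) auto
    show "(\<lambda>n. M * norm (a (Suc n) - a n)) \<longlonglongrightarrow> M * norm (L - L)"
      by (intro tendsto_intros a aS)
    have "(norm (a (Suc n)))\<^sup>2 - (norm (a n))\<^sup>2 / 2 \<le> M * norm (a (Suc n) - a n)" for n
    proof -
      have "r n < r (Suc n)"
        using r by (simp add: strict_mono_Suc_iff)
      then have "(norm (a (Suc n)))\<^sup>2 - (norm (a n))\<^sup>2 / 2 \<le> \<xi> (r n) \<bullet> (a (Suc n) - a n)"
        using later[of "r n" "r (Suc n)"] cut[of "r n"]
        by (simp add: a_def inner_diff_right inner_commute)
      also have "\<dots> \<le> M * norm (a (Suc n) - a n)"
        using \<xi>[of "r n"] by (intro order_trans[OF norm_cauchy_schwarz] mult_right_mono) auto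
      finally show ?thesis .
    qed
    then show "\<exists>N. \<forall>n\<ge>N. (norm (a (Suc n)))\<^sup>2 - (norm (a n))\<^sup>2 / 2 \<le> M * norm (a (Suc n) - a n)"
      by blast
  qed
  then have "L = 0"
    by simp
  moreover have "c \<le> norm L"
    using c(2) by (intro LIMSEQ_le_const[OF tendsto_norm[OF a]]) (auto simp: a_def)
  ultimately show False
    using c(1) by simp
qed

text \<open>The new point is the projection of \<open>x\<close> onto the half-space \<open>{q. (q - y) \<bullet> \<xi> \<le> 0}\<close>, which by
  monotonicity contains all zeros of \<open>T\<close>.\<close>

lemma projection_step_fejer:
  fixes x y \<xi> q :: "'a::real_inner"
  assumes mono: "monotone_op T" and q: "q \<in> op_zeros T" and \<xi>: "\<xi> \<in> T y"
    and pos: "0 < (x - y) \<bullet> \<xi>"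
  defines "x' \<equiv> x - (((x - y) \<bullet> \<xi>) / (norm \<xi>)\<^sup>2) *\<^sub>R \<xi>"
  shows "(norm (x' - q))\<^sup>2 \<le> (norm (x - q))\<^sup>2 - (norm (x' - x))\<^sup>2"
proof -
  define a where "a = (x - y) \<bullet> \<xi>"
  define h where "h = a / (norm \<xi>)\<^sup>2"
  have \<xi>0: "\<xi> \<noteq> 0" and a: "0 < a"
    using pos by (auto simp: a_def)
  have "0 \<le> (\<xi> - 0) \<bullet> (y - q)"
    using monotone_opD[OF mono \<xi>, of 0 q] q by (simp add: op_zeros_def)
  then have "a \<le> (x - q) \<bullet> \<xi>"
    by (simp add: a_def inner_diff_left inner_diff_right inner_commute)
  then have le: "h * a \<le> h * ((x - q) \<bullet> \<xi>)"
    using a \<xi>0 by (intro mult_left_mono) (simp_all add: h_def)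
  have ha: "h * (norm \<xi>)\<^sup>2 = a"
    using \<xi>0 by (simp add: h_def)
  have x'q: "x' - q = (x - q) - h *\<^sub>R \<xi>" and x'x: "x' - x = - (h *\<^sub>R \<xi>)"
    by (simp_all add: x'_def h_def a_def algebra_simps)
  have "(norm (x' - q))\<^sup>2 = (norm (x - q))\<^sup>2 - 2 * (h * ((x - q) \<bullet> \<xi>)) + h * (h * (norm \<xi>)\<^sup>2)"
    unfolding x'q power2_norm_eq_inner
    by (simp add: inner_diff_left inner_diff_right inner_commute algebra_simps)
  moreover have "(norm (x' - x))\<^sup>2 = h * (h * (norm \<xi>)\<^sup>2)"
    unfolding x'x by (simp add: power_mult_distrib power2_eq_square)
  ultimately show ?thesis
    using le unfolding ha by (simp add: mult.commute)
qed

section \<open>An invariant of the algorithm\<close>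

fun bundle_pairs :: "'a config \<Rightarrow> ('a \<times> 'a) set" where
  "bundle_pairs (Stopped k x) = {}"
| "bundle_pairs (Step0 k x p z w) = {(z i, w i) | i. 1 \<le> i \<and> i \<le> p}"
| "bundle_pairs (Step1 k x p z w n j) = {(z i, w i) | i. 1 \<le> i \<and> i \<le> p}"
| "bundle_pairs (Step2 k x p z w n j s l) = {(z i, w i) | i. 1 \<le> i \<and> i \<le> p}"
| "bundle_pairs (Step3 k x p z w n j s y v \<xi>) = {(z i, w i) | i. 1 \<le> i \<and> i \<le> p}"

text \<open>The radius exponent \<open>j\<close> of the current iterate; it is \<open>0\<close> where the algorithm has not set it yet.\<close>

fun level :: "'a config \<Rightarrow> nat" where
  "level (Stopped k x) = 0"
| "level (Step0 k x p z w) = 0"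
| "level (Step1 k x p z w n j) = j"
| "level (Step2 k x p z w n j s l) = j"
| "level (Step3 k x p z w n j s y v \<xi>) = j"

lemma bundle_pairs_update:
  "{((z(Suc p := a)) i, (w(Suc p := b)) i) | i. 1 \<le> i \<and> i \<le> Suc p}
    = insert (a, b) {(z i, w i) | i. 1 \<le> i \<and> i \<le> p}" for p :: nat
proof -
  have "{(f i, g i) | i. 1 \<le> i \<and> i \<le> Suc p}
      = insert (f (Suc p), g (Suc p)) {(f i, g i) | i. 1 \<le> i \<and> i \<le> p}"
    for f :: "nat \<Rightarrow> 'a" and g :: "nat \<Rightarrow> 'b"
    by (auto simp: le_Suc_eq)
  also have "{((z(Suc p := a)) i, (w(Suc p := b)) i) | i. 1 \<le> i \<and> i \<le> p}
      = {(z i, w i) | i. 1 \<le> i \<and> i \<le> p}"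
    by (rule Collect_cong, rule iff_exI) auto
  finally show ?thesis
    by simp
qed

lemma bundle_step_pairs_mono:
  assumes "bundle_step T \<tau> R c c'" "\<not> is_Stopped c'"
  shows "bundle_pairs c \<subseteq> bundle_pairs c'"
  using assms(1)
proof cases
  case stop
  then show ?thesis
    using assms(2) by simp
next
  case (start u x k p z w)
  then show ?thesis
    using bundle_pairs_update[of z p x w u] by (auto simp del: fun_upd_apply)
next
  case (null_step s v \<xi> k x p z w n j y)
  then show ?thesis
    using bundle_pairs_update[of z p y w \<xi>] by (auto simp del: fun_upd_apply)
qed auto

lemma bundle_step_counter:
  assumes "bundle_step T \<tau> R c c'"
  shows "counter c' = counter c \<and> iter c' = iter c \<or> counter c' = Suc (counter c)"
  using assms by cases auto

text \<open>The zero \<open>q0\<close> serves as the centre of a ball that contains every iterate; trial points are at most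
  \<open>R\<close> away from an iterate.\<close>

locale bundle_setting =
  fixes T :: "'a::euclidean_space \<Rightarrow> 'a set" and \<tau> R M :: real and x0 q0 :: 'a
  assumes maximal: "maximal_monotone T"
    and tau_pos: "0 < \<tau>" and R_pos: "0 < R" and M_pos: "0 < M"
    and q0: "q0 \<in> op_zeros T"
    and T_bound: "\<lbrakk> x \<in> cball q0 (dist x0 q0 + R); u \<in> T x \<rbrakk> \<Longrightarrow> norm u \<le> M"
begin

lemma mono: "monotone_op T"
  using maximal by (simp add: maximal_monotone_def)

lemma T_bound_near:
  assumes "dist x q0 \<le> dist x0 q0" "norm (y - x) \<le> R / 2 ^ j" "u \<in> T y"
  shows "norm u \<le> M"
proof -
  have "R / 2 ^ j \<le> R"
    using R_pos by (simp add: field_simps)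
  then have "y \<in> cball q0 (dist x0 q0 + R)"
    using assms(1,2) dist_triangle[of q0 y x] by (simp add: dist_norm norm_minus_commute)
  then show ?thesis
    using T_bound assms(3) by blast
qed

text \<open>A common bound for the three constants \<open>\<tau>\<close>, \<open>R\<close> and \<open>R * M\<close> in the error of an approximate zero.\<close>

definition K :: real where "K = \<tau> + R + R * M"

text \<open>The pairs \<open>(a, b)\<close> in \<open>B\<close> are points with one of their values; the last conjunct is the optimality
  condition for the element of minimal norm in the convex hull of the values near \<open>x\<close>.\<close>

definition cutting_direction :: "'a \<Rightarrow> ('a \<times> 'a) set \<Rightarrow> nat \<Rightarrow> 'a \<Rightarrow> bool" where
  "cutting_direction x B j s \<longleftrightarrow> \<tau> / 2 ^ j < norm s \<and> norm s \<le> M \<and>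
     (\<forall>(a, b)\<in>B. norm (a - x) \<le> R / 2 ^ j \<longrightarrow> (norm s)\<^sup>2 \<le> s \<bullet> b)"

text \<open>In the last clause, an insufficient trial that ends the line search must be the finest one,
  \<open>l = Suc j\<close>; its point is then within \<open>R / 2 ^ j\<close> of \<open>x\<close> and counts in all later directions of level \<open>j\<close>.\<close>

fun stage_ok :: "'a config \<Rightarrow> bool" where
  "stage_ok (Stopped k x) \<longleftrightarrow> x \<in> op_zeros T"
| "stage_ok (Step0 k x p z w) \<longleftrightarrow> True"
| "stage_ok (Step1 k x p z w n j) \<longleftrightarrow> True"
| "stage_ok (Step2 k x p z w n j s l) \<longleftrightarrow>
     cutting_direction x (bundle_pairs (Step2 k x p z w n j s l)) j s \<and> l \<le> Suc j"
| "stage_ok (Step3 k x p z w n j s y v \<xi>) \<longleftrightarrow>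
     cutting_direction x (bundle_pairs (Step3 k x p z w n j s y v \<xi>)) j s \<and> \<xi> \<in> T y \<and>
     (\<exists>l\<le>Suc j. y = x - ((R / 2 ^ l) / norm s) *\<^sub>R s \<and>
        (insufficient s v \<xi> \<longrightarrow> l = Suc j \<and> s \<bullet> \<xi> < (norm s)\<^sup>2 / 2))"

text \<open>Every level that has been passed at the current iterate leaves a certificate of approximate
  vanishing behind.  The certificate does not mention the bundle, so it survives later null steps.\<close>

definition valid :: "'a config \<Rightarrow> bool" where
  "valid c \<longleftrightarrow> dist (iter c) q0 \<le> dist x0 q0 \<and> (\<forall>(a, b)\<in>bundle_pairs c. b \<in> T a) \<and>
     (\<forall>i<level c. approx_zero T (K / 2 ^ i) (iter c)) \<and> stage_ok c"

lemma cutting_direction_pos: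
  assumes "cutting_direction x B j s"
  shows "0 < norm s" "s \<noteq> 0"
proof -
  have "0 < \<tau> / 2 ^ j"
    using tau_pos by simp
  then have "0 < norm s"
    using assms unfolding cutting_direction_def by linarith
  then show "0 < norm s" "s \<noteq> 0"
    by auto
qed

lemma norm_trial_step:
  assumes "s \<noteq> 0"
  shows "norm (((R / 2 ^ l) / norm s) *\<^sub>R s) = R / 2 ^ l"
  using assms R_pos by simp

lemma approx_zero_direction_loop:
  assumes x: "dist x q0 \<le> dist x0 q0" and graph: "\<forall>i. 1 \<le> i \<and> i \<le> p \<longrightarrow> w i \<in> T (z i)"
    and \<alpha>: "\<alpha> \<in> unit_simplex (bundle_near p z x (R / 2 ^ j))"
    and small: "norm (\<Sum>i\<in>bundle_near p z x (R / 2 ^ j). \<alpha> i *\<^sub>R w i) \<le> \<tau> / 2 ^ j"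
  shows "approx_zero T (K / 2 ^ j) x"
proof (rule approx_zero_convex_combination[OF mono \<alpha>, where z = z and w = w and r = "R / 2 ^ j"
      and M = M and \<theta> = "\<tau> / 2 ^ j"])
  show "w i \<in> T (z i)" "norm (z i - x) \<le> R / 2 ^ j"
    if "i \<in> bundle_near p z x (R / 2 ^ j)" for i
    using that graph by (auto simp: bundle_near_def)
  then show "norm (w i) \<le> M" if "i \<in> bundle_near p z x (R / 2 ^ j)" for i
    using that T_bound_near[OF x] by blast
  show "R / 2 ^ j * M \<le> K / 2 ^ j" "R / 2 ^ j \<le> K / 2 ^ j" "\<tau> / 2 ^ j \<le> K / 2 ^ j"
    using tau_pos R_pos M_pos by (auto simp: K_def divide_simps)
qed (rule small)

lemma cutting_direction_min_norm:
  assumes x: "dist x q0 \<le> dist x0 q0" and graph: "\<forall>i. 1 \<le> i \<and> i \<le> p \<longrightarrow> w i \<in> T (z i)"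
    and I: "I = bundle_near p z x (R / 2 ^ j)"
    and min: "is_arg_min (\<lambda>\<beta>. (norm (\<Sum>i\<in>I. \<beta> i *\<^sub>R w i))\<^sup>2) (\<lambda>\<beta>. \<beta> \<in> unit_simplex I) \<alpha>"
    and s: "s = (\<Sum>i\<in>I. \<alpha> i *\<^sub>R w i)" and large: "\<not> norm s \<le> \<tau> / 2 ^ j"
  shows "cutting_direction x {(z i, w i) | i. 1 \<le> i \<and> i \<le> p} j s"
proof -
  have "finite I"
    unfolding I bundle_near_def by (rule finite_subset[of _ "{..p}"]) auto
  then have "(norm s)\<^sup>2 \<le> s \<bullet> w i" if "i \<in> I" for i
    using min_norm_inner_ge[OF min _ that] by (simp add: s inner_commute)
  moreover have "norm s \<le> M"
    unfolding s
  proof (rule norm_simplex_combination_le)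
    show "\<alpha> \<in> unit_simplex I"
      using min by (simp add: is_arg_min_def)
    show "norm (w i) \<le> M" if "i \<in> I" for i
      using that graph T_bound_near[OF x] by (auto simp: I bundle_near_def)
  qed
  ultimately show ?thesis
    using large by (auto simp: cutting_direction_def I bundle_near_def)
qed

text \<open>At the finest trial index \<open>l = j + 1\<close> every bundle point within \<open>R / 2 ^ l\<close> of the trial point
  \<open>y\<close> is within \<open>R / 2 ^ j\<close> of \<open>x\<close>, so the direction \<open>s\<close> already cuts the values collected there and
  \<open>v\<close> passes the test.  A failing test is therefore the fault of \<open>\<xi>\<close>.\<close>

lemma insufficient_at_finest_trial:
  assumes dir: "cutting_direction x {(z i, w i) | i. 1 \<le> i \<and> i \<le> p} j s"
    and y: "y = x - ((R / 2 ^ Suc j) / norm s) *\<^sub>R s"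
    and \<beta>: "\<beta> \<in> unit_simplex (bundle_near p z y (R / 2 ^ Suc j))"
    and v: "v = (\<Sum>i\<in>bundle_near p z y (R / 2 ^ Suc j). \<beta> i *\<^sub>R w i)"
    and ins: "insufficient s v \<xi>"
  shows "s \<bullet> \<xi> < (norm s)\<^sup>2 / 2"
proof -
  note s = cutting_direction_pos[OF dir]
  have "(norm s)\<^sup>2 \<le> s \<bullet> w i" if i: "i \<in> bundle_near p z y (R / 2 ^ Suc j)" for i
  proof -
    have "norm (z i - x) \<le> norm (z i - y) + norm (y - x)"
      using norm_triangle_ineq[of "z i - y" "y - x"] by simp
    moreover have "norm (y - x) = R / 2 ^ Suc j"
      using norm_trial_step[OF s(2), of "Suc j"] by (simp add: y)
    moreover have "norm (z i - y) \<le> R / 2 ^ Suc j"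
      using i by (simp add: bundle_near_def)
    ultimately have "norm (z i - x) \<le> R / 2 ^ j"
      by (simp add: field_simps)
    then show ?thesis
      using dir i by (fastforce simp: cutting_direction_def bundle_near_def)
  qed
  then have "(norm s)\<^sup>2 \<le> v \<bullet> s"
    using sum_simplex_ge[OF \<beta>, of "(norm s)\<^sup>2" "\<lambda>i. s \<bullet> w i"]
    by (simp add: v inner_sum_right inner_commute)
  moreover have "0 < (norm s)\<^sup>2"
    using s by simp
  ultimately show ?thesis
    using ins unfolding insufficient_def by linarith
qed

text \<open>The projection moves \<open>x\<close> by \<open>((x - y) \<bullet> \<xi>) / norm \<xi>\<close>.  The factor \<open>1 / 4 ^ j\<close> arises because both the
  trial distance \<open>R / 2 ^ l\<close>, with \<open>l \<le> Suc j\<close>, and \<open>norm s > \<tau> / 2 ^ j\<close> may be of order \<open>1 / 2 ^ j\<close>.\<close>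

lemma serious_step_fejer:
  assumes dir: "cutting_direction x B j s" and x: "dist x q0 \<le> dist x0 q0"
    and l: "l \<le> Suc j" and y: "y = x - ((R / 2 ^ l) / norm s) *\<^sub>R s"
    and \<xi>: "\<xi> \<in> T y" and suf: "\<not> insufficient s v \<xi>"
    and x': "x' = x - (((x - y) \<bullet> \<xi>) / (norm \<xi>)\<^sup>2) *\<^sub>R \<xi>"
  shows "R * \<tau> / (4 * M) / 4 ^ j \<le> norm (x' - x)"
    and "q \<in> op_zeros T \<Longrightarrow> (norm (x' - q))\<^sup>2 \<le> (norm (x - q))\<^sup>2 - (norm (x' - x))\<^sup>2"
proof -
  note s = cutting_direction_pos[OF dir]
  define a where "a = (x - y) \<bullet> \<xi>"
  have "(norm s)\<^sup>2 / 2 \<le> s \<bullet> \<xi>"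
    using suf by (auto simp: insufficient_def)
  then have "(R / 2 ^ l) / norm s * ((norm s)\<^sup>2 / 2) \<le> a"
    unfolding a_def y using R_pos by (simp del: times_divide_eq_right times_divide_eq_left)
      (intro mult_left_mono, auto)
  then have lower: "(R / 2 ^ l) * norm s / 2 \<le> a"
    using s by (simp add: power2_eq_square)
  have "R * \<tau> / 4 / 4 ^ j = (R / 2 ^ Suc j) * (\<tau> / 2 ^ j) / 2"
    using power_mult_distrib[of "2::real" 2 j] by simp
  also have "\<dots> \<le> (R / 2 ^ l) * norm s / 2"
    using dir l R_pos tau_pos
    by (intro divide_right_mono mult_mono divide_left_mono power_increasing)
      (auto simp: cutting_direction_def)
  also have "\<dots> \<le> a"
    by (rule lower)
  finally have a: "R * \<tau> / 4 / 4 ^ j \<le> a" .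
  moreover have "0 < R * \<tau> / 4 / 4 ^ j"
    using R_pos tau_pos by simp
  ultimately have a0: "0 < a"
    by linarith
  then have \<xi>0: "\<xi> \<noteq> 0"
    by (auto simp: a_def)
  have "norm \<xi> \<le> M"
    using T_bound_near[OF x _ \<xi>, of l] norm_trial_step[OF s(2), of l] by (simp add: y)
  then have "(R * \<tau> / 4 / 4 ^ j) / M \<le> a / norm \<xi>"
    using a a0 \<xi>0 by (intro frac_le) auto
  also have "a / norm \<xi> = norm (x' - x)"
    using a0 \<xi>0 by (simp add: x' flip: a_def) (simp add: power2_eq_square)
  finally show "R * \<tau> / (4 * M) / 4 ^ j \<le> norm (x' - x)"
    by (simp add: mult.commute mult.left_commute)
  show "(norm (x' - q))\<^sup>2 \<le> (norm (x - q))\<^sup>2 - (norm (x' - x))\<^sup>2" if "q \<in> op_zeros T"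
    using projection_step_fejer[OF mono that \<xi>] a0 by (simp add: x' a_def)
qed

lemma valid_step_serious:
  assumes c: "valid c" and step: "bundle_step T \<tau> R c c'" and new: "counter c' = Suc (counter c)"
  shows "R * \<tau> / (4 * M) / 4 ^ level c \<le> norm (iter c' - iter c)"
    and "q \<in> op_zeros T \<Longrightarrow>
      (norm (iter c' - q))\<^sup>2 \<le> (norm (iter c - q))\<^sup>2 - (norm (iter c' - iter c))\<^sup>2"
proof -
  from step new obtain k x p z w n j s y v \<xi> x' where
    ser: "c = Step3 k x p z w n j s y v \<xi>" "iter c' = x'" "\<not> insufficient s v \<xi>"
      "x' = x - (((x - y) \<bullet> \<xi>) / (norm \<xi>)\<^sup>2) *\<^sub>R \<xi>"
    by cases auto
  with c obtain l where l: "l \<le> Suc j" "y = x - ((R / 2 ^ l) / norm s) *\<^sub>R s"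
    by (auto simp: valid_def)
  have "cutting_direction x (bundle_pairs c) j s" "dist x q0 \<le> dist x0 q0" "\<xi> \<in> T y"
    using c by (auto simp: ser(1) valid_def)
  note * = serious_step_fejer[OF this(1,2) l this(3) ser(3,4)]
  show "R * \<tau> / (4 * M) / 4 ^ level c \<le> norm (iter c' - iter c)"
    using *(1) by (simp add: ser(1,2))
  show "(norm (iter c' - q))\<^sup>2 \<le> (norm (iter c - q))\<^sup>2 - (norm (iter c' - iter c))\<^sup>2"
    if "q \<in> op_zeros T"
    using *(2)[OF that] by (simp add: ser(1,2))
qed

lemma valid_step:
  assumes c: "valid c" and step: "bundle_step T \<tau> R c c'"
  shows "valid c'"
  using step
proof cases
  case (stop u x k p z w)
  then show ?thesis
    using c by (simp add: valid_def op_zeros_def)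
next
  case (start u x k p z w)
  then show ?thesis
    using c bundle_pairs_update[of z p x w u] by (auto simp: valid_def simp del: fun_upd_apply)
next
  case (direction_loop I p z x j w \<alpha> s k n)
  have "approx_zero T (K / 2 ^ j) x"
    using c direction_loop by (intro approx_zero_direction_loop[of x p w z \<alpha>])
      (auto simp: valid_def is_arg_min_def)
  then show ?thesis
    using c direction_loop by (auto simp: valid_def less_Suc_eq)
next
  case (direction_found I p z x j w \<alpha> s k n)
  have "cutting_direction x {(z i, w i) | i. 1 \<le> i \<and> i \<le> p} j s"
    using c direction_found by (intro cutting_direction_min_norm[of x p w z I j \<alpha>])
      (auto simp: valid_def)
  then show ?thesis
    using c direction_found by (auto simp: valid_def)
next
  case (search_loop \<sigma> l s y x \<xi> I p z \<beta> v w j k n)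
  then show ?thesis
    using c by (auto simp: valid_def)
next
  case (search_done \<sigma> l s y x \<xi> I p z \<beta> v w j k n)
  have dir: "cutting_direction x {(z i, w i) | i. 1 \<le> i \<and> i \<le> p} j s" and l: "l \<le> Suc j"
    using c search_done by (auto simp: valid_def)
  have "l = Suc j \<and> s \<bullet> \<xi> < (norm s)\<^sup>2 / 2" if ins: "insufficient s v \<xi>"
  proof
    show "l = Suc j"
      using search_done ins l by auto
    then show "s \<bullet> \<xi> < (norm s)\<^sup>2 / 2"
      using search_done ins by (intro insufficient_at_finest_trial[OF dir]) auto
  qed
  then have "stage_ok c'"
    using dir l search_done by auto
  then show ?thesis
    using c search_done by (auto simp: valid_def)
next
  case (null_step s v \<xi> k x p z w n j y)
  then show ?thesis
    using c bundle_pairs_update[of z p y w \<xi>] by (auto simp: valid_def simp del: fun_upd_apply)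
next
  case (serious_step s v \<xi> x' x y k p z w n j)
  have "(norm (x' - q0))\<^sup>2 \<le> (norm (x - q0))\<^sup>2 - (norm (x' - x))\<^sup>2"
    using valid_step_serious(2)[OF c step _ q0] serious_step by auto
  then have "(norm (x' - q0))\<^sup>2 \<le> (norm (x - q0))\<^sup>2"
    by (simp add: order_trans)
  then have "dist x' q0 \<le> dist x q0"
    by (simp add: dist_norm)
  then show ?thesis
    using c serious_step by (auto simp: valid_def)
qed

text \<open>Bounds the number of steps that can pass, at one iterate and with levels at most \<open>J\<close>, before
  a line search finishes.\<close>

fun remaining_work :: "nat \<Rightarrow> 'a config \<Rightarrow> nat" where
  "remaining_work J (Stopped k x) = 0"
| "remaining_work J (Step0 k x p z w) = 2 * J + 4"
| "remaining_work J (Step1 k x p z w n j) = J + 3 + (J - j)"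
| "remaining_work J (Step2 k x p z w n j s l) = j + 2 - l"
| "remaining_work J (Step3 k x p z w n j s y v \<xi>) = 0"

lemma remaining_work_decreases:
  assumes "valid c" "bundle_step T \<tau> R c c'" "\<not> is_Stopped c'" "\<not> is_Step3 c" "level c' \<le> J"
  shows "remaining_work J c' < remaining_work J c"
  using assms(2) by cases (use assms in \<open>auto simp: valid_def\<close>)

text \<open>This collects what successive null steps need in order to be compared: the direction respects the
  old bundle, and the bundle gains a nearby pair that cuts the direction off.\<close>

lemma null_step_cut:
  assumes c: "valid c" and step: "bundle_step T \<tau> R c c'" and old: "counter c' = counter c"
    and s3: "is_Step3 c"
  shows "\<exists>s y \<xi>. cutting_direction (iter c) (bundle_pairs c) (level c) s \<and>
    (y, \<xi>) \<in> bundle_pairs c' \<and> norm (y - iter c) \<le> R / 2 ^ level c \<and> norm \<xi> \<le> M \<and>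
    s \<bullet> \<xi> < (norm s)\<^sup>2 / 2"
  using step
proof cases
  case (null_step s v \<xi> k x p z w n j y)
  have dir: "cutting_direction x (bundle_pairs c) j s" and \<xi>: "\<xi> \<in> T y"
    and y: "y = x - ((R / 2 ^ Suc j) / norm s) *\<^sub>R s" and cut: "s \<bullet> \<xi> < (norm s)\<^sup>2 / 2"
    and x: "dist x q0 \<le> dist x0 q0"
    using c null_step by (auto simp: valid_def)
  have "norm (y - x) = R / 2 ^ Suc j"
    using norm_trial_step[OF cutting_direction_pos(2)[OF dir], of "Suc j"] by (simp add: y)
  then have near: "norm (y - x) \<le> R / 2 ^ j"
    using R_pos by (simp add: field_simps)
  have "(y, \<xi>) \<in> bundle_pairs c'"
    using null_step bundle_pairs_update[of z p y w \<xi>] by (simp del: fun_upd_apply)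
  then show ?thesis
    using dir near T_bound_near[OF x near \<xi>] cut null_step by auto
qed (use s3 old in auto)

section \<open>Convergence of the serious steps\<close>

text \<open>The squared step lengths are at most the decrements of a bounded decreasing sequence, so they
  vanish.
  As short steps only come from deep levels, every cluster point is a zero, and the distance to it
  decreases along the whole sequence.\<close>

lemma fejer_sequence_converges_to_zero:
  assumes fejer: "\<And>k q. q \<in> op_zeros T \<Longrightarrow>
      (norm (X (Suc k) - q))\<^sup>2 \<le> (norm (X k - q))\<^sup>2 - (norm (X (Suc k) - X k))\<^sup>2"
    and progress: "\<And>k. \<exists>j. (\<forall>i<j. approx_zero T (K / 2 ^ i) (X k)) \<and>
      \<delta> / 4 ^ j \<le> norm (X (Suc k) - X k)"
    and \<delta>: "0 < \<delta>"
  shows "\<exists>x. x \<in> op_zeros T \<and> X \<longlonglongrightarrow> x"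
proof -
  have dec: "decseq (\<lambda>k. (norm (X k - q))\<^sup>2)" if "q \<in> op_zeros T" for q
  proof (rule decseq_SucI)
    fix k
    show "(norm (X (Suc k) - q))\<^sup>2 \<le> (norm (X k - q))\<^sup>2"
      using fejer[OF that, of k] zero_le_power2[of "norm (X (Suc k) - X k)"] by linarith
  qed
  have conv: "\<exists>L. (\<lambda>k. (norm (X k - q))\<^sup>2) \<longlonglongrightarrow> L" if "q \<in> op_zeros T" for q
    using decseq_convergent[OF dec[OF that], of 0] by auto
  obtain L where L: "(\<lambda>k. (norm (X k - q0))\<^sup>2) \<longlonglongrightarrow> L"
    using conv[OF q0] by blast
  have "(\<lambda>k. (norm (X k - q0))\<^sup>2 - (norm (X (Suc k) - q0))\<^sup>2) \<longlonglongrightarrow> L - L"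
    by (intro tendsto_diff L LIMSEQ_Suc[OF L])
  then have decr: "(\<lambda>k. (norm (X k - q0))\<^sup>2 - (norm (X (Suc k) - q0))\<^sup>2) \<longlonglongrightarrow> 0"
    by simp
  have deep: "\<forall>\<^sub>F k in sequentially. approx_zero T (K / 2 ^ B) (X k)" for B
  proof -
    have "\<forall>\<^sub>F k in sequentially.
        (norm (X k - q0))\<^sup>2 - (norm (X (Suc k) - q0))\<^sup>2 < (\<delta> / 4 ^ B)\<^sup>2"
      using \<delta> by (intro order_tendstoD(2)[OF decr]) simp
    then show ?thesis
    proof eventually_elim
      case (elim k)
      obtain j where j: "\<forall>i<j. approx_zero T (K / 2 ^ i) (X k)" "\<delta> / 4 ^ j \<le> norm (X (Suc k) - X k)"
        using progress by blast
      have "(norm (X (Suc k) - X k))\<^sup>2 < (\<delta> / 4 ^ B)\<^sup>2"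
        using elim fejer[OF q0, of k] by linarith
      then have "norm (X (Suc k) - X k) < \<delta> / 4 ^ B"
        using \<delta> by (intro power2_less_imp_less[of _ "\<delta> / 4 ^ B"]) auto
      then have "\<delta> / 4 ^ j < \<delta> / 4 ^ B"
        using j(2) by linarith
      moreover have "\<delta> / 4 ^ B \<le> \<delta> / 4 ^ j" if "j \<le> B"
        using that \<delta> by (intro divide_left_mono power_increasing) auto
      ultimately have "B < j"
        by (meson leD not_le_imp_less)
      then show ?case
        using j(1) by blast
    qed
  qed
  have "X k \<in> cball q0 (norm (X 0 - q0))" for k
  proof -
    have "(norm (X k - q0))\<^sup>2 \<le> (norm (X 0 - q0))\<^sup>2"
      using decseqD[OF dec[OF q0], of 0 k] by simp
    then show ?thesis
      by (simp add: dist_norm norm_minus_commute)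
  qed
  then obtain x r where r: "strict_mono r" and x: "(X \<circ> r) \<longlonglongrightarrow> x"
    using compact_imp_seq_compact[OF compact_cball, unfolded seq_compact_def] by blast
  have zero: "x \<in> op_zeros T"
  proof (rule zero_if_approx_zero_geometric[OF maximal])
    fix i
    show "approx_zero T (K / 2 ^ i) x"
      by (rule approx_zero_limit[OF _ x]) (use eventually_subseq[OF r deep[of i]] in simp)
  qed
  obtain E where E: "(\<lambda>k. (norm (X k - x))\<^sup>2) \<longlonglongrightarrow> E"
    using conv[OF zero] by blast
  have "(\<lambda>k. (norm ((X \<circ> r) k - x))\<^sup>2) \<longlonglongrightarrow> (norm (x - x))\<^sup>2"
    by (intro tendsto_intros x)
  then have "E = 0"
    using LIMSEQ_unique[OF LIMSEQ_subseq_LIMSEQ[OF E r]] by (simp add: comp_def)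
  then have "(\<lambda>k. (norm (X k - x))\<^sup>2) \<longlonglongrightarrow> 0"
    using E by simp
  then have "(\<lambda>k. norm (X k - x)) \<longlonglongrightarrow> 0"
    using tendsto_real_sqrt[of "\<lambda>k. (norm (X k - x))\<^sup>2" 0] by simp
  then have "X \<longlonglongrightarrow> x"
    by (simp add: LIM_zero_cancel tendsto_norm_zero_iff)
  then show ?thesis
    using zero by blast
qed

end

section \<open>Complete runs\<close>

locale bundle_trace = bundle_setting +
  fixes \<rho> :: "nat \<Rightarrow> 'a config"
  assumes run: "bundle_run T \<tau> R x0 \<rho>"
begin

lemma trace_start: "\<exists>z w. \<rho> 0 = Step0 0 x0 0 z w"
  using run by (simp add: bundle_run_def)

lemma trace_step: "\<not> is_Stopped (\<rho> t) \<Longrightarrow> bundle_step T \<tau> R (\<rho> t) (\<rho> (Suc t))"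
  using run by (auto simp: bundle_run_def)

lemma trace_stopped: "is_Stopped (\<rho> t) \<Longrightarrow> \<rho> (Suc t) = \<rho> t"
  using run by (auto simp: bundle_run_def)

lemma trace_valid: "valid (\<rho> t)"
proof (induction t)
  case 0
  then show ?case
    using trace_start by (auto simp: valid_def)
next
  case (Suc t)
  then show ?case
    using valid_step trace_step trace_stopped by (cases "is_Stopped (\<rho> t)") auto
qed

lemma trace_counter:
  "counter (\<rho> (Suc t)) = counter (\<rho> t) \<and> iter (\<rho> (Suc t)) = iter (\<rho> t) \<or>
   counter (\<rho> (Suc t)) = Suc (counter (\<rho> t))"
  using bundle_step_counter[OF trace_step] trace_stopped by (cases "is_Stopped (\<rho> t)") auto

lemma trace_counter_mono: "t \<le> t' \<Longrightarrow> counter (\<rho> t) \<le> counter (\<rho> t')"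
proof (rule lift_Suc_mono_le[of "\<lambda>t. counter (\<rho> t)"])
  show "counter (\<rho> n) \<le> counter (\<rho> (Suc n))" for n
    using trace_counter[of n] by linarith
qed

lemma trace_iter: "iter (\<rho> t) = iterate \<rho> (counter (\<rho> t))"
proof -
  \<comment> \<open>Between the first time with this counter value and \<open>t\<close> the counter is constant by monotonicity.\<close>
  define t0 where "t0 = (LEAST t'. counter (\<rho> t') = counter (\<rho> t))"
  have t0: "counter (\<rho> t0) = counter (\<rho> t)"
    unfolding t0_def by (rule LeastI[of _ t]) simp
  have "t0 \<le> t"
    unfolding t0_def by (rule Least_le) simp
  then have "counter (\<rho> t) = counter (\<rho> t0) \<longrightarrow> iter (\<rho> t) = iter (\<rho> t0)"
  proof (induction t rule: dec_induct)
    case (step n)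
    then show ?case
      using trace_counter[of n] trace_counter_mono[of t0 n] by auto
  qed simp
  then show ?thesis
    using t0 by (simp add: iterate_def flip: t0_def)
qed

lemma infinite_run_converges:
  assumes "infinite (iterate_indices \<rho>)"
  shows "\<exists>x. x \<in> op_zeros T \<and> iterate \<rho> \<longlonglongrightarrow> x"
proof -
  \<comment> \<open>Counters increase by at most one, so an infinite range leaves no value out, and the first time
    beyond \<open>k\<close> is the end of a serious step.\<close>
  have switch: "\<exists>t. counter (\<rho> t) = k \<and> counter (\<rho> (Suc t)) = Suc k" for k
  proof -
    define t1 where "t1 = (LEAST t. k < counter (\<rho> t))"
    have "\<exists>t. k < counter (\<rho> t)"
      using assms unfolding iterate_indices_def infinite_nat_iff_unbounded by blast
    then have t1: "k < counter (\<rho> t1)"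
      unfolding t1_def by (rule LeastI_ex)
    have "t1 \<noteq> 0"
      using t1 trace_start by (intro notI) auto
    then obtain t where t: "t1 = Suc t"
      by (cases t1) auto
    then have "counter (\<rho> t) \<le> k"
      using not_less_Least[of t "\<lambda>t. k < counter (\<rho> t)"] by (simp add: t1_def)
    then show ?thesis
      using t1 trace_counter[of t] unfolding t by (intro exI[of _ t]) linarith
  qed
  have serious: "\<exists>c c'. valid c \<and> bundle_step T \<tau> R c c' \<and> counter c' = Suc (counter c) \<and>
    iter c = iterate \<rho> k \<and> iter c' = iterate \<rho> (Suc k)" for k
  proof -
    obtain t where t: "counter (\<rho> t) = k" "counter (\<rho> (Suc t)) = Suc k"
      using switch by blast
    then have "\<not> is_Stopped (\<rho> t)"
      using trace_stopped[of t] by auto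
    then show ?thesis
      using t trace_step[of t] trace_valid[of t] trace_iter[of t] trace_iter[of "Suc t"] by auto
  qed
  show ?thesis
  proof (rule fejer_sequence_converges_to_zero)
    show "0 < R * \<tau> / (4 * M)"
      using R_pos tau_pos M_pos by simp
  next
    fix k
    obtain c c' where "valid c" "bundle_step T \<tau> R c c'" "counter c' = Suc (counter c)"
      "iter c = iterate \<rho> k" "iter c' = iterate \<rho> (Suc k)"
      using serious by blast
    note c = this valid_step_serious[OF this(1-3)]
    show "\<exists>j. (\<forall>i<j. approx_zero T (K / 2 ^ i) (iterate \<rho> k)) \<and>
        R * \<tau> / (4 * M) / 4 ^ j \<le> norm (iterate \<rho> (Suc k) - iterate \<rho> k)"
      using c(1,4,5,6) by (intro exI[of _ "level c"]) (auto simp: valid_def)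
    show "(norm (iterate \<rho> (Suc k) - q))\<^sup>2
        \<le> (norm (iterate \<rho> k - q))\<^sup>2 - (norm (iterate \<rho> (Suc k) - iterate \<rho> k))\<^sup>2"
      if "q \<in> op_zeros T" for q
      using c(4,5) c(7)[OF that] by simp
  qed
qed

text \<open>Bounded levels would force infinitely many null steps at one common level, each adding a cut
  that all later directions of that level respect; bounded directions with norms bounded away from \<open>0\<close>
  do not admit this.\<close>

lemma level_unbounded:
  assumes never: "\<And>t. \<not> is_Stopped (\<rho> t)"
    and const: "\<And>t. t0 \<le> t \<Longrightarrow> counter (\<rho> t) = m"
  shows "\<exists>t\<ge>t0. J < level (\<rho> t)"
proof (rule ccontr)
  assume "\<not> ?thesis"
  then have J: "\<And>t. t0 \<le> t \<Longrightarrow> level (\<rho> t) \<le> J"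
    by (meson not_le_imp_less)
  define x where "x = iterate \<rho> m"
  have iter: "\<And>t. t0 \<le> t \<Longrightarrow> iter (\<rho> t) = x"
    using trace_iter const by (simp add: x_def)
  have reach: "\<exists>t'\<ge>t. is_Step3 (\<rho> t')" if "t0 \<le> t" for t
    using that
  proof (induction "remaining_work J (\<rho> t)" arbitrary: t rule: less_induct)
    case less
    show ?case
    proof (cases "is_Step3 (\<rho> t)")
      case False
      have "remaining_work J (\<rho> (Suc t)) < remaining_work J (\<rho> t)"
        using less.prems False J[of "Suc t"] never
        by (intro remaining_work_decreases trace_valid trace_step) auto
      then show ?thesis
        using less.hyps[of "Suc t"] less.prems by (meson Suc_leD le_SucI)
    qed blast
  qed
  define A where "A = {t. t0 \<le> t \<and> is_Step3 (\<rho> t)}"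
  have "infinite A"
    unfolding infinite_nat_iff_unbounded_le
  proof
    fix t
    show "\<exists>t'\<ge>t. t' \<in> A"
      using reach[of "max t t0"] by (auto simp: A_def)
  qed
  moreover have "(\<lambda>t. level (\<rho> t)) ` A \<subseteq> {..J}"
    using J by (auto simp: A_def)
  then have "finite ((\<lambda>t. level (\<rho> t)) ` A)"
    by (rule finite_subset) simp
  ultimately obtain a where a: "infinite {t \<in> A. level (\<rho> t) = level (\<rho> a)}"
    using pigeonhole_infinite by blast
  define j where "j = level (\<rho> a)"
  define e where "e = enumerate {t \<in> A. level (\<rho> t) = j}"
  have e: "strict_mono e" "\<And>n. e n \<in> A" "\<And>n. level (\<rho> (e n)) = j"
    using a strict_mono_enumerate enumerate_in_set[of "{t \<in> A. level (\<rho> t) = j}"]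
    unfolding e_def j_def by auto
  have t0: "\<And>n. t0 \<le> e n" "\<And>n. is_Step3 (\<rho> (e n))"
    using e(2) by (auto simp: A_def)
  have "\<exists>s y \<xi>. cutting_direction x (bundle_pairs (\<rho> (e n))) j s \<and>
      (y, \<xi>) \<in> bundle_pairs (\<rho> (Suc (e n))) \<and> norm (y - x) \<le> R / 2 ^ j \<and> norm \<xi> \<le> M \<and>
      s \<bullet> \<xi> < (norm s)\<^sup>2 / 2" for n
    using null_step_cut[OF trace_valid trace_step[OF never], of "e n"] t0[of n] const[of "e n"]
      const[of "Suc (e n)"] iter[of "e n"] e(3)[of n] by simp
  then obtain s y \<xi> where cut:
    "\<And>n. cutting_direction x (bundle_pairs (\<rho> (e n))) j (s n)"
    "\<And>n. (y n, \<xi> n) \<in> bundle_pairs (\<rho> (Suc (e n)))"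
    "\<And>n. norm (y n - x) \<le> R / 2 ^ j" "\<And>n. norm (\<xi> n) \<le> M"
    "\<And>n. s n \<bullet> \<xi> n < (norm (s n))\<^sup>2 / 2"
    by metis
  have pairs_mono: "bundle_pairs (\<rho> t) \<subseteq> bundle_pairs (\<rho> t')" if "t \<le> t'" for t t'
    using that by (rule lift_Suc_mono_le[of "\<lambda>t. bundle_pairs (\<rho> t)", rotated])
      (rule bundle_step_pairs_mono[OF trace_step[OF never] never])
  show False
  proof (rule no_infinite_cut_sequence[of s M \<xi> "\<tau> / 2 ^ j"])
    show "norm (s n) \<le> M" "\<tau> / 2 ^ j \<le> norm (s n)" for n
      using cut(1)[of n] by (auto simp: cutting_direction_def)
    show "0 < \<tau> / 2 ^ j"
      using tau_pos by simp
    show "(norm (s m))\<^sup>2 \<le> s m \<bullet> \<xi> n" if "n < m" for n m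
    proof -
      have "Suc (e n) \<le> e m"
        using e(1) that by (simp add: strict_mono_less Suc_le_eq)
      then have "(y n, \<xi> n) \<in> bundle_pairs (\<rho> (e m))"
        using cut(2) pairs_mono by blast
      then show ?thesis
        using cut(1)[of m] cut(3)[of n] by (auto simp: cutting_direction_def)
    qed
  qed (use cut in auto)
qed

lemma finite_run_ends_at_zero:
  assumes fin: "finite (iterate_indices \<rho>)"
  shows "iterate \<rho> (Max (iterate_indices \<rho>)) \<in> op_zeros T"
proof -
  define m where "m = Max (iterate_indices \<rho>)"
  have "m \<in> iterate_indices \<rho>"
    unfolding m_def using fin by (intro Max_in) (auto simp: iterate_indices_def)
  then obtain t0 where t0: "counter (\<rho> t0) = m"
    by (auto simp: iterate_indices_def)
  have const: "counter (\<rho> t) = m" if "t0 \<le> t" for t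
  proof (rule antisym)
    show "counter (\<rho> t) \<le> m"
      unfolding m_def using fin by (intro Max_ge) (auto simp: iterate_indices_def)
    show "m \<le> counter (\<rho> t)"
      using trace_counter_mono[OF that] t0 by simp
  qed
  have "iterate \<rho> m \<in> op_zeros T"
  proof (cases "\<exists>t. is_Stopped (\<rho> t)")
    case True
    then obtain t where t: "is_Stopped (\<rho> t)"
      by blast
    have "is_Stopped (\<rho> (t + d))" for d
      by (induction d) (use t trace_stopped in auto)
    then have "is_Stopped (\<rho> (t + t0))"
      by blast
    then have "iter (\<rho> (t + t0)) \<in> op_zeros T"
      using trace_valid[of "t + t0"] by (cases "\<rho> (t + t0)") (auto simp: valid_def)
    then show ?thesis
      using trace_iter[of "t + t0"] const[of "t + t0"] by simp
  next
    case False
    show ?thesis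
    proof (rule zero_if_approx_zero_geometric[OF maximal])
      fix i
      obtain t where "t0 \<le> t" "i < level (\<rho> t)"
        using level_unbounded[of t0 m i] False const by blast
      then show "approx_zero T (K / 2 ^ i) (iterate \<rho> m)"
        using trace_valid[of t] trace_iter[of t] const[of t] by (auto simp: valid_def)
    qed
  qed
  then show ?thesis
    by (simp add: m_def)
qed

end

theorem theorem3p12:
  fixes T :: "real ^ 'N \<Rightarrow> (real ^ 'N) set"
    and x0 :: "real ^ 'N"
    and \<tau> R :: real
    and \<rho> :: "nat \<Rightarrow> (real ^ 'N) config"
  assumes "maximal_monotone T"
    and "op_dom T = UNIV"
    and "op_zeros T \<noteq> {}"
    and "\<tau> > 0"
    and "R > 0"
    and "bundle_run T \<tau> R x0 \<rho>"
  shows "(finite (iterate_indices \<rho>) \<and>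
            iterate \<rho> (Max (iterate_indices \<rho>)) \<in> op_zeros T) \<or>
         (infinite (iterate_indices \<rho>) \<and>
            (\<exists>x. x \<in> op_zeros T \<and> iterate \<rho> \<longlonglongrightarrow> x))"
proof -
  obtain q0 where q0: "q0 \<in> op_zeros T"
    using assms(3) by blast
  have "monotone_op T"
    using assms(1) by (simp add: maximal_monotone_def)
  then obtain M where M: "M > 0" "\<And>x u. \<lbrakk> x \<in> cball q0 (dist x0 q0 + R); u \<in> T x \<rbrakk> \<Longrightarrow> norm u \<le> M"
    using monotone_op_bounded_on_cball[OF _ assms(2)] by blast
  interpret bundle_trace T \<tau> R M x0 q0 \<rho>
    using assms q0 M by unfold_locales auto
  show ?thesis
    using finite_run_ends_at_zero infinite_run_converges by blast
qed

end
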